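(* Let $\vec{G}$ be an oriented graph. If $\Delta_{\min}(\vec{G}) \geq 2$, then $\vec{\chi}(\vec{G}) \leq \Delta_{\min}(\vec{G})$.
   Context: An oriented graph is a finite digraph without loops, parallel arcs, or pairs of opposite arcs between the same two vertices. For a vertex $v$, $d^+(v)$ and $d^-(v)$ denote its out-degree and in-degree, and $\Delta_{\min}(\vec{G})=\max_{v\in V(\vec{G})} \min\{d^+(v),d^-(v)\}$. A $k$-dicolouring of $\vec{G}$ is a function $c:V(\vec{G})\to\{1,\dots,k\}$ such that for each $i$ the set $c^{-1}(i)$ induces a subdigraph with no directed cycle. The dichromatic number $\vec{\chi}(\vec{G})$ is the smallest $k$ such that $\vec{G}$ has a $k$-dicolouring. *)

theory Defs
  imports "Graph_Theory.Graph_Theory"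
begin

text \<open>The locale \<^locale>\<open>digraph\<close> already provides finiteness and excludes loops and parallel arcs.\<close>

locale oriented_graph = digraph +
  assumes no_opposite_arcs: "u \<rightarrow>\<^bsub>G\<^esub> v \<Longrightarrow> \<not> v \<rightarrow>\<^bsub>G\<^esub> u"

text \<open>The maximum over the vertices of the null graph is read as 0.\<close>

definition Delta_min :: "('a, 'b) pre_digraph \<Rightarrow> nat" where
  "Delta_min G = (if verts G = {} then 0
     else Max ((\<lambda>v. min (out_degree G v) (in_degree G v)) ` verts G))"

text \<open>
  In the library a cycle may have length 1 or 2; oriented graphs have no such cycles.
  The colour classes are intersected with the vertex set because the function is total and
  \<^const>\<open>induce_subgraph\<close> takes its second argument as the new vertex set.
\<close>

definition dicolouring :: "('a, 'b) pre_digraph \<Rightarrow> nat \<Rightarrow> ('a \<Rightarrow> nat) \<Rightarrow> bool" where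
  "dicolouring G k c \<longleftrightarrow>
     c \<in> verts G \<rightarrow> {1..k} \<and>
     (\<forall>i\<in>{1..k}. \<not> (\<exists>p. pre_digraph.cycle (G \<restriction> {v \<in> verts G. c v = i}) p))"

definition dichromatic_number :: "('a, 'b) pre_digraph \<Rightarrow> nat" where
  "dichromatic_number G = (LEAST k. \<exists>c. dicolouring G k c)"

text \<open>A digraph has some dicolouring, so the least number above exists.\<close>

lemma (in digraph) dicolouring_exists: "\<exists>c. dicolouring G (card (verts G)) c"
proof -
  obtain c where c: "bij_betw c (verts G) {1..card (verts G)}"
    using ex_bij_betw_finite_nat[OF finite_verts] finite_same_card_bij[OF finite_verts, of "{1..card (verts G)}"]
    by auto
  have "\<not> pre_digraph.cycle (G \<restriction> {v \<in> verts G. c v = i}) p" for i p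
  proof
    let ?H = "G \<restriction> {v \<in> verts G. c v = i}"
    assume "pre_digraph.cycle ?H p"
    then obtain e where "e \<in> arcs ?H"
      unfolding pre_digraph.cycle_def pre_digraph.awalk_def by (cases p) auto
    then have "e \<in> arcs G" "c (tail G e) = c (head G e)" by auto
    with c have "tail G e = head G e"
      by (auto simp: bij_betw_def dest: inj_onD)
    with no_loops \<open>e \<in> arcs G\<close> show False by blast
  qed
  moreover have "c \<in> verts G \<rightarrow> {1..card (verts G)}"
    using c by (auto simp: bij_betw_def)
  ultimately show ?thesis unfolding dicolouring_def by blast
qed

end

theory Submission
  imports Defs
begin

text \<open>
  Let \<open>k = \<Delta>\<^sub>m\<^sub>i\<^sub>n\<close>, let \<open>X\<close> be the set of vertices of out-degree at most \<open>k\<close> and \<open>Y\<close> its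
  complement, so that all in-degrees in \<open>Y\<close> are at most \<open>k\<close>.  Form an auxiliary digraph \<open>H\<close> in
  which a vertex of \<open>X\<close> keeps its out-neighbours and a vertex of \<open>Y\<close> gets its in-neighbours as new
  out-neighbours.  Then all out-degrees in \<open>H\<close> are at most \<open>k\<close>, arcs from \<open>X\<close> to \<open>Y\<close> have become
  digons (pairs of opposite arcs), arcs from \<open>Y\<close> to \<open>X\<close> have disappeared, and there are no other
  digons.  A \<open>k\<close>-dicolouring of \<open>H\<close> is one of the original digraph: no arc from \<open>X\<close> to \<open>Y\<close> is
  monochromatic, so a monochromatic cycle would stay inside \<open>X\<close> or inside \<open>Y\<close>, where \<open>H\<close> is the
  original digraph or its reverse.

  It remains to prove a Brooks-type theorem (\<open>bipartite_digons_dicolourable\<close>): a digraph with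
  out-degrees at most \<open>k \<ge> 2\<close> whose digons form a bipartite graph is \<open>k\<close>-dicolourable.  The argument
  works in a minimal counterexample and rests on greedy colouring: a vertex can be coloured as soon
  as some colour is missing among its out-neighbours, or among its in-neighbours, so a directed path
  can be coloured from its start as long as the vertex after its end is still uncoloured.

  \<^item> Every directed path extends to a Hamiltonian cycle (\<open>path_extends_to_hamiltonian_cycle\<close>).  A
    maximal path ends in a cycle \<open>C\<close> that contains all out-neighbours of the last vertex.  If \<open>C\<close>
    were not everything, one could colour the rest, give a vertex of \<open>C\<close> without out-neighbours
    outside \<open>C\<close> the colour of an outer out-neighbour of its predecessor, and colour greedily around
    \<open>C\<close>; the predecessor comes last and has two out-neighbours of one colour.
  \<^item> If two out-neighbours \<open>a\<close>, \<open>b\<close> of \<open>v\<close> do not form a digon, then \<open>v\<close> has no neighbours besides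
    \<open>a\<close> and \<open>b\<close> (\<open>neighbours_of_non_digon_pair\<close>).  Otherwise one gives \<open>a\<close> and \<open>b\<close> the same colour
    and colours the rest of a Hamiltonian cycle greedily, with \<open>v\<close> last.
  \<^item> All in- and out-degrees equal \<open>k\<close>, and there is no triangle of digons, so \<open>k = 2\<close>.  The second
    fact then forces every arc to lie in a digon, and the bipartition is a 2-dicolouring.
\<close>

section \<open>Dicolourings of binary relations\<close>

definition mono_arcs :: "('a \<times> 'a) set \<Rightarrow> 'a set \<Rightarrow> ('a \<Rightarrow> nat) \<Rightarrow> ('a \<times> 'a) set" where
  "mono_arcs R V c = {(u, v) \<in> R. u \<in> V \<and> v \<in> V \<and> c u = c v}"

text \<open>
  A cycle in a colour class is the same as a cycle of monochromatic arcs, so a single acyclicity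
  condition covers all colours.
\<close>

definition dicol :: "('a \<times> 'a) set \<Rightarrow> nat \<Rightarrow> 'a set \<Rightarrow> ('a \<Rightarrow> nat) \<Rightarrow> bool" where
  "dicol R k V c \<longleftrightarrow> c \<in> V \<rightarrow> {1..k} \<and> acyclic (mono_arcs R V c)"

text \<open>A closed walk can never return from \<open>A\<close> to \<open>B\<close>, so it stays in one of the two layers.\<close>

lemma acyclic_layered:
  assumes "acyclic r" "acyclic s" and r: "r \<subseteq> A \<times> A" and s: "s \<subseteq> B \<times> B"
    and t: "t \<subseteq> B \<times> A" and disj: "A \<inter> B = {}"
  shows "acyclic (r \<union> s \<union> t)"
proof -
  have rp: "r\<^sup>+ \<subseteq> A \<times> A" and sp: "s\<^sup>+ \<subseteq> B \<times> B"
    using r s by (auto dest: trancl_subset_Sigma)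
  have key: "(x \<in> A \<longrightarrow> (x, y) \<in> r\<^sup>+) \<and> (y \<in> B \<longrightarrow> (x, y) \<in> s\<^sup>+) \<and> x \<in> A \<union> B"
    if "(x, y) \<in> (r \<union> s \<union> t)\<^sup>+" for x y
    using that
  proof (induction rule: trancl_induct)
    case (base y)
    then show ?case using r s t disj by blast
  next
    case (step y z)
    have "(x, z) \<in> r\<^sup>+" if "x \<in> A"
    proof -
      have "(x, y) \<in> r\<^sup>+" using step that by blast
      moreover from this have "(y, z) \<in> r" using rp step(2) s t disj by blast
      ultimately show ?thesis by (rule trancl_into_trancl)
    qed
    moreover have "(x, z) \<in> s\<^sup>+" if "z \<in> B"
    proof -
      have "(y, z) \<in> s" using that step(2) r t disj by blast
      moreover from this have "(x, y) \<in> s\<^sup>+" using s step by blast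
      ultimately show ?thesis by (meson trancl_into_trancl)
    qed
    ultimately show ?case using step by blast
  qed
  show ?thesis
    unfolding acyclic_def
  proof (intro allI notI)
    fix x assume "(x, x) \<in> (r \<union> s \<union> t)\<^sup>+"
    from key[OF this] show False using assms(1,2) by (auto simp: acyclic_def)
  qed
qed

lemma dicol_Un:
  assumes "dicol R k A c" "dicol R k B c" "A \<inter> B = {}"
    and "\<And>u v. (u, v) \<in> R \<Longrightarrow> u \<in> A \<Longrightarrow> v \<in> B \<Longrightarrow> c u \<noteq> c v"
  shows "dicol R k (A \<union> B) c"
proof -
  have "mono_arcs R (A \<union> B) c
      = mono_arcs R A c \<union> mono_arcs R B c \<union> {(u, v) \<in> R. u \<in> B \<and> v \<in> A \<and> c u = c v}"
    using assms(4) by (auto simp: mono_arcs_def)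
  moreover have "acyclic \<dots>"
    by (rule acyclic_layered[where A = A and B = B])
      (use assms(1-3) in \<open>auto simp: dicol_def mono_arcs_def\<close>)
  ultimately show ?thesis using assms(1,2) by (auto simp: dicol_def)
qed

lemma dicol_cong:
  assumes "\<And>x. x \<in> V \<Longrightarrow> c x = d x"
  shows "dicol R k V c \<longleftrightarrow> dicol R k V d"
proof -
  have "mono_arcs R V c = mono_arcs R V d" using assms by (auto simp: mono_arcs_def)
  then show ?thesis using assms by (auto simp: dicol_def Pi_iff)
qed

lemma dicol_converse: "dicol (R\<inverse>) k V c \<longleftrightarrow> dicol R k V c"
proof -
  have "mono_arcs (R\<inverse>) V c = (mono_arcs R V c)\<inverse>" by (auto simp: mono_arcs_def)
  then show ?thesis by (simp add: dicol_def)
qed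

lemma dicol_singleton: "(x, x) \<notin> R \<Longrightarrow> c x \<in> {1..k} \<Longrightarrow> dicol R k {x} c"
  by (auto simp: dicol_def mono_arcs_def acyclic_def dest: tranclD)

lemma dicol_independent:
  assumes "c \<in> V \<rightarrow> {1..k}" "mono_arcs R V c = {}"
  shows "dicol R k V c"
  using assms by (auto simp: dicol_def acyclic_def)

section \<open>Greedy colouring\<close>

lemma dicol_insert_sink:
  assumes "dicol R k W c" "x \<notin> W" "(x, x) \<notin> R" "q \<in> {1..k}"
    and "\<And>y. (x, y) \<in> R \<Longrightarrow> y \<in> W \<Longrightarrow> c y \<noteq> q"
  shows "dicol R k (insert x W) (c(x := q))"
proof -
  have "dicol R k W (c(x := q)) \<longleftrightarrow> dicol R k W c"
    by (rule dicol_cong) (use assms(2) in auto)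
  then have "dicol R k ({x} \<union> W) (c(x := q))"
    using assms by (intro dicol_Un dicol_singleton) auto
  then show ?thesis by simp
qed

lemma dicol_insert_missing_colour:
  assumes "finite W" "dicol R k W c" "x \<notin> W" "(x, x) \<notin> R"
    and few: "card (c ` (R `` {x} \<inter> W)) < k"
  shows "\<exists>q. dicol R k (insert x W) (c(x := q))"
proof -
  have "\<not> {1..k} \<subseteq> c ` (R `` {x} \<inter> W)"
    using few assms(1) card_mono[of "c ` (R `` {x} \<inter> W)" "{1..k}"] by auto
  then obtain q where "q \<in> {1..k}" "q \<notin> c ` (R `` {x} \<inter> W)" by blast
  then have "dicol R k (insert x W) (c(x := q))"
    by (intro dicol_insert_sink[OF assms(2-4)]) auto
  then show ?thesis by blast
qed

lemma dicol_insert_small_degree: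
  assumes "finite W" "dicol R k W c" "x \<notin> W" "(x, x) \<notin> R" "card (R `` {x} \<inter> W) < k"
  shows "\<exists>q. dicol R k (insert x W) (c(x := q))"
  using dicol_insert_missing_colour[OF assms(1-4)] assms(1,5)
    card_image_le[of "R `` {x} \<inter> W" c] by auto

lemma dicol_insert_uncoloured_neighbour:
  assumes "finite V" "dicol R k W c" "x \<notin> W" "(x, x) \<notin> R" "W \<subseteq> V"
    and "card (R `` {x} \<inter> V) \<le> k" "(x, y) \<in> R" "y \<in> V - W"
  shows "\<exists>q. dicol R k (insert x W) (c(x := q))"
proof (rule dicol_insert_small_degree)
  have "R `` {x} \<inter> W \<subset> R `` {x} \<inter> V" using assms(5,7,8) by blast
  then have "card (R `` {x} \<inter> W) < card (R `` {x} \<inter> V)"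
    using assms(1) by (intro psubset_card_mono) auto
  then show "card (R `` {x} \<inter> W) < k" using assms(6) by simp
  show "finite W" using assms(1,5) by (rule rev_finite_subset)
qed (fact assms)+

lemma dicol_insert_repeated_colour:
  assumes "finite V" "dicol R k W c" "x \<notin> W" "(x, x) \<notin> R" "W \<subseteq> V"
    and "card (R `` {x} \<inter> V) \<le> k"
    and "(x, u) \<in> R" "(x, w) \<in> R" "u \<in> W" "w \<in> W" "u \<noteq> w" "c u = c w"
  shows "\<exists>q. dicol R k (insert x W) (c(x := q))"
proof (rule dicol_insert_missing_colour)
  let ?N = "R `` {x} \<inter> W"
  have W: "finite W" using assms(1,5) by (rule rev_finite_subset)
  then have fin: "finite ?N" by simp
  have "c ` ?N = c ` (?N - {u})" using assms(7-12) by (auto simp: image_iff)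
  then have "card (c ` ?N) \<le> card (?N - {u})" using fin by (simp add: card_image_le)
  also have "\<dots> < card ?N" using fin assms by (intro psubset_card_mono) auto
  also have "\<dots> \<le> card (R `` {x} \<inter> V)" using assms(1,5) by (intro card_mono) auto
  finally show "card (c ` ?N) < k" using assms(6) by simp
  show "finite W" using assms(1,5) by (rule rev_finite_subset)
qed (fact assms)+

text \<open>When a vertex of the path is coloured, its successor on the path is not yet coloured.\<close>

lemma dicol_greedy_path:
  assumes "finite V" "\<And>x. (x, x) \<notin> R" "\<And>x. x \<in> V \<Longrightarrow> card (R `` {x} \<inter> V) \<le> k"
    and "dicol R k A c" "A \<subseteq> V"
    and "successively (\<lambda>x y. (x, y) \<in> R) (xs @ [y])" "distinct (xs @ [y])"
    and "set (xs @ [y]) \<subseteq> V - A"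
  shows "\<exists>d. dicol R k (A \<union> set xs) d \<and> (\<forall>a\<in>A. d a = c a)"
  using assms(4-)
proof (induction xs arbitrary: A c)
  case Nil
  then have "dicol R k (A \<union> set []) c" by simp
  then show ?case by blast
next
  case (Cons x xs)
  obtain z where z: "(x, z) \<in> R" "z \<in> set (xs @ [y])"
    using Cons.prems(3) by (cases xs) auto
  have "z \<in> V - A" using z Cons.prems(5) by auto
  then have "\<exists>q. dicol R k (insert x A) (c(x := q))"
    by (intro dicol_insert_uncoloured_neighbour[where V = V and y = z])
      (use assms(1-3) Cons.prems z in auto)
  then obtain q where q: "dicol R k (insert x A) (c(x := q))" by blast
  have "successively (\<lambda>x y. (x, y) \<in> R) (xs @ [y])"
    using Cons.prems(3) by (cases xs) auto
  moreover have "insert x A \<subseteq> V" "distinct (xs @ [y])" "set (xs @ [y]) \<subseteq> V - insert x A"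
    using Cons.prems(2,4,5) by auto
  ultimately obtain d where d: "dicol R k (insert x A \<union> set xs) d"
      "\<forall>a\<in>insert x A. d a = (c(x := q)) a"
    using Cons.IH[OF q] by blast
  have "x \<notin> A" using Cons.prems(5) by simp
  then have "\<forall>a\<in>A. d a = c a" using d(2) by simp
  moreover have "dicol R k (A \<union> set (x # xs)) d" using d(1) by simp
  ultimately show ?case by blast
qed

section \<open>Minimal counterexamples\<close>

locale minimal_undicolourable =
  fixes R :: "('a \<times> 'a) set" and V :: "'a set" and k :: nat
  assumes finite_V: "finite V"
    and irrefl: "(x, x) \<notin> R"
    and k_pos: "k \<ge> 1"
    and outdeg_le: "x \<in> V \<Longrightarrow> card (R `` {x} \<inter> V) \<le> k"
    and undicolourable: "\<not> dicol R k V c"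
    and proper_dicolourable: "W \<subset> V \<Longrightarrow> \<exists>c. dicol R k W c"
begin

abbreviation path :: "'a list \<Rightarrow> bool" where
  "path \<equiv> successively (\<lambda>x y. (x, y) \<in> R)"

lemma outdeg_ge:
  assumes "x \<in> V" shows "card (R `` {x} \<inter> V) \<ge> k"
proof (rule ccontr)
  assume less: "\<not> k \<le> card (R `` {x} \<inter> V)"
  obtain c where c: "dicol R k (V - {x}) c" using proper_dicolourable[of "V - {x}"] assms by blast
  have "R `` {x} \<inter> (V - {x}) = R `` {x} \<inter> V" using irrefl by auto
  then have "\<exists>q. dicol R k (insert x (V - {x})) (c(x := q))"
    by (intro dicol_insert_small_degree[OF _ c]) (use finite_V irrefl less in auto)
  then show False using undicolourable assms by (simp add: insert_absorb)
qed

lemma indeg_ge: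
  assumes "x \<in> V" shows "card (R\<inverse> `` {x} \<inter> V) \<ge> k"
proof (rule ccontr)
  assume less: "\<not> k \<le> card (R\<inverse> `` {x} \<inter> V)"
  obtain c where c: "dicol (R\<inverse>) k (V - {x}) c"
    using proper_dicolourable[of "V - {x}"] assms unfolding dicol_converse by blast
  have "R\<inverse> `` {x} \<inter> (V - {x}) = R\<inverse> `` {x} \<inter> V" using irrefl by auto
  then have "\<exists>q. dicol (R\<inverse>) k (insert x (V - {x})) (c(x := q))"
    by (intro dicol_insert_small_degree[OF _ c]) (use finite_V irrefl less in auto)
  then show False using undicolourable assms by (simp add: insert_absorb dicol_converse)
qed

lemma outdeg_eq: "x \<in> V \<Longrightarrow> card (R `` {x} \<inter> V) = k"
  using outdeg_ge outdeg_le by (simp add: le_antisym)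

text \<open>All in-degrees are at least \<open>k\<close>, and their sum, the number of arcs, is only \<open>k * card V\<close>.\<close>

lemma indeg_eq:
  assumes "x \<in> V" shows "card (R\<inverse> `` {x} \<inter> V) = k"
proof (rule ccontr)
  assume "card (R\<inverse> `` {x} \<inter> V) \<noteq> k"
  then have "card (R\<inverse> `` {x} \<inter> V) > k" using indeg_ge[OF assms] by simp
  then have "(\<Sum>x\<in>V. k) < (\<Sum>x\<in>V. card (R\<inverse> `` {x} \<inter> V))"
    using assms finite_V indeg_ge by (intro sum_strict_mono_ex1) auto
  moreover have "(\<Sum>x\<in>V. card (R\<inverse> `` {x} \<inter> V)) = (\<Sum>x\<in>V. card (R `` {x} \<inter> V))"
  proof -
    have "(\<Sum>x\<in>V. card {y \<in> V. (y, x) \<in> R}) = (\<Sum>y\<in>V. card {x \<in> V. (y, x) \<in> R})"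
      using sum_multicount_gen[OF finite_V finite_V, of "\<lambda>y x. (y, x) \<in> R"
          "\<lambda>x. card {y \<in> V. (y, x) \<in> R}"] by simp
    moreover have "R\<inverse> `` {x} \<inter> V = {y \<in> V. (y, x) \<in> R}" "R `` {x} \<inter> V = {y \<in> V. (x, y) \<in> R}" for x
      by auto
    ultimately show ?thesis by simp
  qed
  ultimately show False using outdeg_eq by simp
qed

lemma greedy_path:
  assumes "dicol R k A c" "A \<subseteq> V" "path (xs @ [y])" "distinct (xs @ [y])"
    "set (xs @ [y]) \<subseteq> V - A"
  shows "\<exists>d. dicol R k (A \<union> set xs) d \<and> (\<forall>a\<in>A. d a = c a)"
  by (rule dicol_greedy_path[where V = V and y = y]; (rule finite_V irrefl outdeg_le assms; assumption?)?)

lemma greedy_path_reverse: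
  assumes "dicol R k A c" "A \<subseteq> V" "path (y # xs)" "distinct (y # xs)"
    "set (y # xs) \<subseteq> V - A"
  shows "\<exists>d. dicol R k (A \<union> set xs) d \<and> (\<forall>a\<in>A. d a = c a)"
proof -
  have "successively (\<lambda>x y. (x, y) \<in> R\<inverse>) (rev (y # xs))"
    using assms(3) by (subst successively_rev) simp
  then have path: "successively (\<lambda>x y. (x, y) \<in> R\<inverse>) (rev xs @ [y])" by simp
  have "\<exists>d. dicol (R\<inverse>) k (A \<union> set (rev xs)) d \<and> (\<forall>a\<in>A. d a = c a)"
  proof (rule dicol_greedy_path[where V = V and y = y])
    show "card (R\<inverse> `` {x} \<inter> V) \<le> k" if "x \<in> V" for x using indeg_eq[OF that] by simp
    show "dicol (R\<inverse>) k A c" using assms(1) by (simp add: dicol_converse)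
    show "set (rev xs @ [y]) \<subseteq> V - A" "distinct (rev xs @ [y])" using assms(4,5) by auto
  qed (use path assms(2) finite_V irrefl in simp_all)
  then show ?thesis by (simp add: dicol_converse)
qed

text \<open>
  If no arc leaves \<open>C\<close>, dicolourings of \<open>C\<close> and of the rest combine.  Otherwise some \<open>x\<close> on the
  cycle has an out-neighbour \<open>u\<close> outside \<open>C\<close> while its successor \<open>y\<close> has none.  Once the rest is
  coloured, \<open>y\<close> can copy the colour of \<open>u\<close>, since it is a sink at that moment.  Continuing along the
  cycle, one colours \<open>x\<close> last, and \<open>x\<close> sees the same colour on \<open>u\<close> and on \<open>y\<close>.
\<close>

lemma closed_cycle_spans:
  assumes path: "path C" and dist: "distinct C" and ne: "C \<noteq> []" and sub: "set C \<subseteq> V"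
    and close: "(last C, hd C) \<in> R" and absorb: "R `` {last C} \<inter> V \<subseteq> set C"
  shows "set C = V"
proof (rule ccontr)
  assume neq: "set C \<noteq> V"
  have "V - set C \<subset> V" using ne sub by (cases C) auto
  then obtain c where c: "dicol R k (V - set C) c" using proper_dicolourable by blast
  have exit: "\<exists>x\<in>set C. R `` {x} \<inter> V - set C \<noteq> {}"
  proof (rule ccontr)
    assume no: "\<not> ?thesis"
    obtain d where d: "dicol R k (set C) d" using proper_dicolourable sub neq by blast
    let ?e = "\<lambda>x. if x \<in> set C then d x else c x"
    have "dicol R k (set C) ?e" using d dicol_cong[of "set C" d ?e] by simp
    moreover have "dicol R k (V - set C) ?e" using c dicol_cong[of "V - set C" c ?e] by simp
    ultimately have "dicol R k (set C \<union> (V - set C)) ?e" using no by (intro dicol_Un) auto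
    then show False using undicolourable sub by (simp add: Un_absorb1)
  qed
  obtain C1 x C2 where C: "C = C1 @ x # C2" and x: "R `` {x} \<inter> V - set C \<noteq> {}"
    and C2: "\<forall>z\<in>set C2. \<not> R `` {z} \<inter> V - set C \<noteq> {}"
    using split_list_last_prop[OF exit] by blast
  have "C2 \<noteq> []" using x absorb C by auto
  then obtain y C3 where C2y: "C2 = y # C3" by (cases C2) auto
  obtain u where u: "(x, u) \<in> R" "u \<in> V" "u \<notin> set C" using x by auto
  have xy: "(x, y) \<in> R" using path C C2y by (auto simp: successively_append_iff)
  have 0: "dicol R k (insert y (V - set C)) (c(y := c u))"
  proof (rule dicol_insert_sink[OF c])
    show "y \<notin> V - set C" "(y, y) \<notin> R" using C C2y irrefl by auto
    show "c u \<in> {1..k}" using c u by (auto simp: dicol_def)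
    fix z assume "(y, z) \<in> R" "z \<in> V - set C"
    then show "c z \<noteq> c u" using C2 C2y by auto
  qed
  \<comment> \<open>The cycle without \<open>y\<close>, read from the successor of \<open>y\<close> round to \<open>x\<close>.\<close>
  have "path ((C3 @ C1) @ [x])"
  proof -
    have "path C3" "path (C1 @ [x])"
      using path C C2y by (auto simp: successively_append_iff successively_Cons)
    moreover have "C3 \<noteq> [] \<Longrightarrow> (last C3, hd (C1 @ [x])) \<in> R"
      using close C C2y by (cases C1) auto
    ultimately have "path (C3 @ (C1 @ [x]))" by (subst successively_append_iff) blast
    then show ?thesis by simp
  qed
  then have "\<exists>d. dicol R k (insert y (V - set C) \<union> set (C3 @ C1)) d \<and>
      (\<forall>a\<in>insert y (V - set C). d a = (c(y := c u)) a)"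
    using dist sub C C2y by (intro greedy_path[OF 0]) auto
  then obtain d where d: "dicol R k (insert y (V - set C) \<union> set (C3 @ C1)) d"
    "\<forall>a\<in>insert y (V - set C). d a = (c(y := c u)) a" by blast
  have "insert y (V - set C) \<union> set (C3 @ C1) = V - {x}"
    using dist sub C C2y by auto
  with d(1) have d1: "dicol R k (V - {x}) d" by simp
  have xV: "x \<in> V" and "y \<in> V" "x \<noteq> y" "u \<noteq> x" "u \<noteq> y" using u sub C C2y dist by auto
  moreover have "d u = d y" using d(2) u \<open>u \<noteq> y\<close> by auto
  ultimately have "\<exists>q. dicol R k (insert x (V - {x})) (d(x := q))"
    using finite_V irrefl outdeg_le u xy
    by (intro dicol_insert_repeated_colour[OF finite_V d1, of x u y]) auto
  then show False using undicolourable xV by (simp add: insert_absorb)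
qed

text \<open>
  A longest extension ends in a vertex whose out-neighbours all lie on the path.  From the first of
  these onwards the path closes to a cycle that spans \<open>V\<close>, so nothing precedes that out-neighbour.
\<close>

lemma path_extends_to_hamiltonian_cycle:
  assumes "path P" "distinct P" "P \<noteq> []" "set P \<subseteq> V"
  shows "\<exists>Q. path (P @ Q) \<and> distinct (P @ Q) \<and> set (P @ Q) = V \<and> (last (P @ Q), hd P) \<in> R"
proof -
  let ?ok = "\<lambda>Q. path (P @ Q) \<and> distinct (P @ Q) \<and> set (P @ Q) \<subseteq> V"
  have "length Q < Suc (card V)" if "?ok Q" for Q
    using that finite_V card_mono[of V "set Q"] distinct_card[of Q] by auto
  then have "\<forall>Q. ?ok Q \<longrightarrow> length Q < Suc (card V)" by blast
  moreover have "?ok []" using assms by simp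
  ultimately have "\<exists>Q. ?ok Q \<and> (\<forall>Q'. ?ok Q' \<longrightarrow> length Q' \<le> length Q)"
    by (intro ex_has_greatest_nat[where P = ?ok and k = "[]"])
  then obtain Q where Q: "?ok Q" and max: "\<And>Q'. ?ok Q' \<Longrightarrow> length Q' \<le> length Q" by blast
  define L where "L = P @ Q"
  have L: "path L" "distinct L" "set L \<subseteq> V" "L \<noteq> []" using Q assms by (auto simp: L_def)
  let ?z = "last L"
  have absorb: "R `` {?z} \<inter> V \<subseteq> set L"
  proof (rule ccontr)
    assume "\<not> ?thesis"
    then obtain w where "(?z, w) \<in> R" "w \<in> V" "w \<notin> set L" by auto
    then have "?ok (Q @ [w])" using L Q
      by (auto simp: L_def successively_append_iff simp flip: append_assoc)
    then show False using max by fastforce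
  qed
  have "?z \<in> V" using L last_in_set by blast
  then have "R `` {?z} \<inter> V \<noteq> {}" using outdeg_ge k_pos by fastforce
  then have "\<exists>x\<in>set L. (?z, x) \<in> R" using absorb by auto
  then obtain L1 x L2 where split: "L = L1 @ x # L2" "(?z, x) \<in> R" "\<forall>w\<in>set L1. (?z, w) \<notin> R"
    using split_list_first_prop[of L "\<lambda>x. (?z, x) \<in> R"] by auto
  have "set (x # L2) = V"
  proof (rule closed_cycle_spans)
    show "path (x # L2)" using L(1) split(1) by (simp add: successively_append_iff)
    show "(last (x # L2), hd (x # L2)) \<in> R" using split by simp
    show "R `` {last (x # L2)} \<inter> V \<subseteq> set (x # L2)" using absorb split by auto
  qed (use L split in auto)
  moreover from this have "L1 = []" using L split by (cases L1) auto
  ultimately have "set L = V" "(last L, hd L) \<in> R" using split by auto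
  moreover have "hd L = hd P" using assms by (simp add: L_def)
  ultimately show ?thesis using L unfolding L_def by auto
qed

text \<open>
  Let \<open>v, a, S, b, T\<close> be a Hamiltonian cycle and give \<open>a\<close> and \<open>b\<close> the same colour.  If \<open>S\<close> could be
  coloured next, then so could \<open>T\<close> and finally \<open>v\<close>, which sees the repeated colour.  Hence \<open>S\<close> is
  not empty.  Moreover no arc joins a vertex \<open>s\<close> of \<open>S\<close> to a vertex of \<open>T\<close> or to \<open>v\<close>: otherwise
  \<open>S\<close> could be coloured greedily from both ends towards \<open>s\<close>.

  The path \<open>v, b, T\<close> extends to a second Hamiltonian cycle, in which \<open>a\<close> and \<open>S\<close> follow in some order.
  The last vertex has an arc to \<open>v\<close>, so it is \<open>a\<close>.  If \<open>T\<close> were not empty, the vertex after \<open>T\<close>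
  would be \<open>a\<close> as well, which leaves no room for \<open>S\<close>.  So \<open>T\<close> is empty, and only \<open>a\<close> and \<open>b\<close> remain
  as neighbours of \<open>v\<close>.
\<close>

lemma neighbours_of_non_digon_pair:
  assumes v: "v \<in> V" and a: "(v, a) \<in> R" "a \<in> V" and b: "(v, b) \<in> R" "b \<in> V"
    and ab: "a \<noteq> b" and nodigon: "\<not> ((a, b) \<in> R \<and> (b, a) \<in> R)"
  shows "R `` {v} \<inter> V \<subseteq> {a, b}" "R\<inverse> `` {v} \<inter> V \<subseteq> {a, b}"
proof -
  have va: "v \<noteq> a" and vb: "v \<noteq> b" using a b irrefl by auto
  obtain Q where Q: "path ([v, a] @ Q)" "distinct ([v, a] @ Q)" "set ([v, a] @ Q) = V"
      "(last ([v, a] @ Q), hd [v, a]) \<in> R"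
    using path_extends_to_hamiltonian_cycle[of "[v, a]"] v a va by auto
  have "b \<in> set Q" using Q(3) b ab vb by auto
  then obtain S T where ST: "Q = S @ b # T" by (meson split_list)
  have V: "V = {v, a, b} \<union> set S \<union> set T" using Q(3) ST by auto
  have dist: "distinct ([v, a, b] @ S @ T)" using Q(2) ST by auto
  have pS: "path (a # S @ [b])" and pT: "path (b # T)"
    using Q(1) ST by (auto simp: successively_append_iff successively_Cons hd_append)
  have pTv: "path (T @ [v])"
    using pT Q(4) ST by (auto simp: successively_append_iff successively_Cons split: if_splits)
  have finish: False if c: "dicol R k ({a, b} \<union> set S) c" "c a = c b" for c
  proof -
    have "\<exists>d. dicol R k ({a, b} \<union> set S \<union> set T) d \<and> (\<forall>x\<in>{a, b} \<union> set S. d x = c x)"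
      using pTv dist V by (intro greedy_path[OF c(1)]) auto
    then obtain d where d: "dicol R k ({a, b} \<union> set S \<union> set T) d"
      "\<forall>x\<in>{a, b} \<union> set S. d x = c x" by blast
    have "\<exists>q. dicol R k (insert v ({a, b} \<union> set S \<union> set T)) (d(v := q))"
      by (rule dicol_insert_repeated_colour[OF finite_V d(1) _ irrefl _ outdeg_le[OF v]
            a(1) b(1) _ _ ab])
        (use dist V c(2) d(2) in auto)
    moreover have "insert v ({a, b} \<union> set S \<union> set T) = V" using V by auto
    ultimately show False using undicolourable by auto
  qed
  have start: "dicol R k {a, b} (\<lambda>_. 1)"
  proof -
    have one: "dicol R k {a} (\<lambda>_. 1)" "dicol R k {b} (\<lambda>_. 1)"
      using irrefl k_pos by (auto intro: dicol_singleton)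
    show ?thesis
    proof (cases "(a, b) \<in> R")
      case False
      then have "dicol R k ({a} \<union> {b}) (\<lambda>_. 1)" using one ab by (intro dicol_Un) auto
      then show ?thesis by (simp add: insert_commute)
    next
      case True
      then have "dicol R k ({b} \<union> {a}) (\<lambda>_. 1)" using one ab nodigon by (intro dicol_Un) auto
      then show ?thesis by (simp add: insert_commute)
    qed
  qed
  have S_ne: "S \<noteq> []" using finish[of "\<lambda>_. 1"] start by auto
  have sep: "(s, t) \<notin> R \<and> (t, s) \<notin> R" if s: "s \<in> set S" and t: "t \<in> insert v (set T)" for s t
  proof (rule ccontr)
    assume adj: "\<not> ?thesis"
    obtain S1 S2 where S: "S = S1 @ s # S2" using s by (meson split_list)
    have p1: "path (S1 @ [s])" and p2: "path (s # S2)"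
      using pS S
      by (auto simp: successively_append_iff successively_Cons hd_append split: if_splits)
    have "\<exists>d. dicol R k ({a, b} \<union> set S1) d \<and> (\<forall>x\<in>{a, b}. d x = 1)"
      using p1 dist V S by (intro greedy_path[OF start]) auto
    then obtain d where d: "dicol R k ({a, b} \<union> set S1) d" "\<forall>x\<in>{a, b}. d x = 1" by blast
    have "\<exists>e. dicol R k ({a, b} \<union> set S1 \<union> set S2) e \<and> (\<forall>x\<in>{a, b} \<union> set S1. e x = d x)"
      using p2 dist V S by (intro greedy_path_reverse[OF d(1)]) auto
    then obtain e where e: "dicol R k ({a, b} \<union> set S1 \<union> set S2) e"
      "\<forall>x\<in>{a, b} \<union> set S1. e x = d x" by blast
    let ?W = "{a, b} \<union> set S1 \<union> set S2"
    have sW: "s \<notin> ?W" "?W \<subseteq> V" "t \<in> V - ?W" "s \<in> V" using dist V S t by auto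
    have "\<exists>q. dicol R k (insert s ?W) (e(s := q))"
    proof (cases "(s, t) \<in> R")
      case True
      then show ?thesis using sW irrefl outdeg_le
        by (intro dicol_insert_uncoloured_neighbour[OF finite_V e(1)]) auto
    next
      case False
      then have "(s, t) \<in> R\<inverse>" using adj by auto
      then have "\<exists>q. dicol (R\<inverse>) k (insert s ?W) (e(s := q))" using sW irrefl indeg_eq e(1)
        by (intro dicol_insert_uncoloured_neighbour[OF finite_V, where y = t])
          (auto simp: dicol_converse)
      then show ?thesis by (simp add: dicol_converse)
    qed
    then obtain q where q: "dicol R k (insert s ?W) (e(s := q))" by blast
    have "insert s ?W = {a, b} \<union> set S" using S by auto
    then show False using finish[of "e(s := q)"] q e(2) d(2) sW by auto
  qed
  obtain Q' where Q': "path ([v, b] @ T @ Q')" "distinct ([v, b] @ T @ Q')"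
      "set ([v, b] @ T @ Q') = V" "(last ([v, b] @ T @ Q'), v) \<in> R"
  proof -
    have "path ([v, b] @ T)" using pT b by simp
    then show ?thesis
      using path_extends_to_hamiltonian_cycle[of "[v, b] @ T"] dist V that by auto
  qed
  have setQ': "set Q' = insert a (set S)" using Q'(2,3) V dist by auto
  then have Q'_ne: "Q' \<noteq> []" by auto
  then have "last Q' \<in> insert a (set S)" using setQ' last_in_set by blast
  moreover have "(last Q', v) \<in> R" using Q'(4) Q'_ne by simp
  ultimately have last: "last Q' = a" using sep[of "last Q'" v] by auto
  have "T = []"
  proof (rule ccontr)
    assume T: "T \<noteq> []"
    then have "(last T, hd Q') \<in> R" using Q'(1) Q'_ne by (auto simp: successively_append_iff successively_Cons)
    moreover have "last T \<in> insert v (set T)" using T by simp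
    ultimately have "hd Q' = a"
      using sep[of "hd Q'" "last T"] setQ' Q'_ne hd_in_set[of Q'] by auto
    then have "Q' = [a]" using last Q'(2) Q'_ne by (cases Q') (auto split: if_splits)
    then show False using setQ' S_ne dist by (cases S) auto
  qed
  then show "R `` {v} \<inter> V \<subseteq> {a, b}" "R\<inverse> `` {v} \<inter> V \<subseteq> {a, b}"
    using V irrefl sep by auto
qed

end

section \<open>A Brooks-type theorem for digraphs with bipartite digons\<close>

text \<open>
  For \<open>k \<ge> 3\<close>, three out-neighbours of a vertex contain a pair that is no digon, which bounds the
  out-degree by 2.  For \<open>k = 2\<close>, the two out-neighbours of a vertex never form a digon; then they are
  also its in-neighbours, and every arc lies in a digon.
\<close>

lemma (in minimal_undicolourable) bipartite_digons_contradiction: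
  assumes k: "k \<ge> 2"
    and bip: "\<And>u v. (u, v) \<in> R \<Longrightarrow> (v, u) \<in> R \<Longrightarrow> u \<in> X \<longleftrightarrow> v \<notin> X"
  shows False
proof -
  have no_triangle: False
    if "(a, b) \<in> R \<and> (b, a) \<in> R" "(a, c) \<in> R \<and> (c, a) \<in> R" "(b, c) \<in> R \<and> (c, b) \<in> R" for a b c
    using that bip by blast
  have "V \<noteq> {}"
    using undicolourable by (auto simp: dicol_def mono_arcs_def acyclic_def)
  have k2: "k = 2"
  proof (rule ccontr)
    assume "k \<noteq> 2"
    obtain v where v: "v \<in> V" using \<open>V \<noteq> {}\<close> by blast
    then have "3 \<le> card (R `` {v} \<inter> V)" using outdeg_eq k \<open>k \<noteq> 2\<close> by simp
    then obtain B where B: "B \<subseteq> R `` {v} \<inter> V" "card B = 3"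
      by (meson obtain_subset_with_card_n)
    then obtain a b c where abc: "B = {a, b, c}" "a \<noteq> b" "a \<noteq> c" "b \<noteq> c"
      by (auto simp: card_3_iff)
    have small: "(x, y) \<in> R \<and> (y, x) \<in> R" if "x \<in> B" "y \<in> B" "x \<noteq> y" for x y
    proof (rule ccontr)
      assume "\<not> ?thesis"
      then have "R `` {v} \<inter> V \<subseteq> {x, y}"
        using that B v by (intro neighbours_of_non_digon_pair(1)) auto
      then have "B \<subseteq> {x, y}" using B by auto
      then show False using abc by auto
    qed
    show False using no_triangle[of a b c] small abc by auto
  qed
  have out: "\<exists>a b. a \<noteq> b \<and> R `` {v} \<inter> V = {a, b}" if "v \<in> V" for v
    using outdeg_eq[OF that] k2 by (auto simp: card_2_iff)
  have indeg_pair: "R\<inverse> `` {v} \<inter> V = {a, b}" if "v \<in> V" "a \<noteq> b" "{a, b} \<subseteq> R\<inverse> `` {v} \<inter> V" for v a b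
    using card_seteq[of "R\<inverse> `` {v} \<inter> V" "{a, b}"] indeg_eq[OF that(1)] k2 that finite_V by auto
  have non_digon_in_neighbours: "R\<inverse> `` {v} \<inter> V = {a, b}"
    if "v \<in> V" "a \<noteq> b" "R `` {v} \<inter> V = {a, b}" "\<not> ((a, b) \<in> R \<and> (b, a) \<in> R)" for v a b
  proof (rule card_seteq)
    show "R\<inverse> `` {v} \<inter> V \<subseteq> {a, b}" using that by (intro neighbours_of_non_digon_pair(2)) auto
    show "card {a, b} \<le> card (R\<inverse> `` {v} \<inter> V)" using indeg_eq that k2 by simp
  qed simp
  \<comment> \<open>The in-neighbours of \<open>a\<close> are \<open>b\<close> and \<open>v\<close>, so the second out-neighbour \<open>c\<close> of \<open>a\<close> is not
    among them; hence \<open>b\<close> and \<open>c\<close> form a digon, but the in-neighbours of \<open>b\<close> are \<open>a\<close> and \<open>v\<close>.\<close>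
  have no_digon_over_one_way_arc: False
    if v: "v \<in> V" "R `` {v} \<inter> V = {a, b}" "a \<noteq> b" and ab: "(a, b) \<in> R" "(b, a) \<in> R"
      and nav: "(a, v) \<notin> R" for v a b
  proof -
    have aV: "a \<in> V" "b \<in> V" "(v, a) \<in> R" "(v, b) \<in> R" using v by auto
    have "v \<noteq> b" using aV irrefl by auto
    then have ina: "R\<inverse> `` {a} \<inter> V = {b, v}" using indeg_pair[of a b v] aV ab v by auto
    obtain c where c: "c \<noteq> b" "R `` {a} \<inter> V = {b, c}"
      using out[OF aV(1)] ab aV by (auto simp: set_eq_iff) metis
    have cV: "c \<in> V" "(a, c) \<in> R" "c \<noteq> v" using c nav by auto
    have cna: "(c, a) \<notin> R" using ina cV c by auto
    show False
    proof (cases "(b, c) \<in> R \<and> (c, b) \<in> R")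
      case True
      have "v \<noteq> a" "c \<noteq> a" using aV cV irrefl by auto
      have "R\<inverse> `` {b} \<inter> V = {a, v}" using indeg_pair[of b a v] aV ab v \<open>v \<noteq> a\<close> by auto
      then show False using True cV \<open>c \<noteq> a\<close> by auto
    next
      case False
      then have "R\<inverse> `` {a} \<inter> V = {b, c}" using non_digon_in_neighbours[of a b c] aV c by auto
      then show False using cna by auto
    qed
  qed
  have sym: "(w, v) \<in> R" if vw: "(v, w) \<in> R" "v \<in> V" "w \<in> V" for v w
  proof -
    obtain a b where N: "a \<noteq> b" "R `` {v} \<inter> V = {a, b}" using out[OF vw(2)] by blast
    have "\<not> ((a, b) \<in> R \<and> (b, a) \<in> R)"
    proof
      assume dig: "(a, b) \<in> R \<and> (b, a) \<in> R"
      have "(a, v) \<in> R" "(b, v) \<in> R"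
        using no_digon_over_one_way_arc[OF vw(2) N(2,1)] no_digon_over_one_way_arc[OF vw(2), of b a] N dig by (auto simp: insert_commute)
      then show False using no_triangle[of a b v] dig N by auto
    qed
    then have "R\<inverse> `` {v} \<inter> V = {a, b}" using non_digon_in_neighbours vw(2) N by blast
    then show ?thesis using N vw by auto
  qed
  have "dicol R k V (\<lambda>v. if v \<in> X then 1 else 2)"
  proof (rule dicol_independent)
    show "mono_arcs R V (\<lambda>v. if v \<in> X then 1 else 2) = {}"
      using sym bip by (auto simp: mono_arcs_def split: if_splits)
  qed (use k in auto)
  then show False using undicolourable by blast
qed

theorem bipartite_digons_dicolourable:
  assumes "finite V" "\<And>x. (x, x) \<notin> R" "k \<ge> 2"
    and "\<And>x. x \<in> V \<Longrightarrow> card (R `` {x} \<inter> V) \<le> k"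
    and bip: "\<And>u v. (u, v) \<in> R \<Longrightarrow> (v, u) \<in> R \<Longrightarrow> u \<in> X \<longleftrightarrow> v \<notin> X"
  shows "\<exists>c. dicol R k V c"
  using assms(1,4)
proof (induction V rule: finite_psubset_induct)
  case (psubset V)
  show ?case
  proof (rule ccontr)
    assume undic: "\<not> ?case"
    have "\<exists>c. dicol R k W c" if "W \<subset> V" for W
    proof (rule psubset.IH[OF that])
      fix x assume "x \<in> W"
      have "card (R `` {x} \<inter> W) \<le> card (R `` {x} \<inter> V)"
        using that psubset.hyps by (intro card_mono) auto
      then show "card (R `` {x} \<inter> W) \<le> k" using psubset.prems[of x] \<open>x \<in> W\<close> that by force
    qed
    then interpret minimal_undicolourable R V k
      using psubset assms(2,3) undic by unfold_locales auto
    show False using bipartite_digons_contradiction[OF assms(3) bip] by blast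
  qed
qed

section \<open>Oriented graphs\<close>

text \<open>
  Each vertex contributes to the auxiliary digraph \<open>H\<close> whichever of its out-neighbourhood and
  in-neighbourhood is small.
\<close>

lemma oriented_min_degree_dicolourable:
  assumes fin: "finite V" and irr: "\<And>x. (x, x) \<notin> R" and orient: "\<And>x y. (x, y) \<in> R \<Longrightarrow> (y, x) \<notin> R"
    and k: "k \<ge> 2"
    and deg: "\<And>x. x \<in> V \<Longrightarrow> card (R `` {x} \<inter> V) \<le> k \<or> card (R\<inverse> `` {x} \<inter> V) \<le> k"
  shows "\<exists>c. dicol R k V c"
proof -
  define X where "X = {x. card (R `` {x} \<inter> V) \<le> k}"
  define H where "H = {(u, v). if u \<in> X then (u, v) \<in> R else (v, u) \<in> R}"
  have "\<exists>c. dicol H k V c"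
  proof (rule bipartite_digons_dicolourable[OF fin _ k])
    show "(x, x) \<notin> H" for x using irr by (auto simp: H_def)
    show "u \<in> X \<longleftrightarrow> v \<notin> X" if "(u, v) \<in> H" "(v, u) \<in> H" for u v
      using that orient by (auto simp: H_def split: if_splits)
    fix x assume "x \<in> V"
    have "H `` {x} = (if x \<in> X then R `` {x} else R\<inverse> `` {x})" by (auto simp: H_def)
    then show "card (H `` {x} \<inter> V) \<le> k" using deg[OF \<open>x \<in> V\<close>] by (auto simp: X_def)
  qed
  then obtain c where c: "c \<in> V \<rightarrow> {1..k}" "acyclic (mono_arcs H V c)" by (auto simp: dicol_def)
  let ?M = "mono_arcs H V c"
  have acyc: "acyclic (mono_arcs H W c)" if "W \<subseteq> V" for W
    using c(2) by (rule acyclic_subset) (use that in \<open>auto simp: mono_arcs_def\<close>)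
  have MX: "mono_arcs R (V \<inter> X) c = mono_arcs H (V \<inter> X) c"
    and MY: "mono_arcs R (V - X) c = (mono_arcs H (V - X) c)\<inverse>"
    by (auto simp: mono_arcs_def H_def)
  have "dicol R k (V \<inter> X \<union> (V - X)) c"
  proof (rule dicol_Un)
    show "dicol R k (V \<inter> X) c" "dicol R k (V - X) c"
      using c(1) acyc[of "V \<inter> X"] acyc[of "V - X"] MX MY by (auto simp: dicol_def)
    fix u v assume uv: "(u, v) \<in> R" "u \<in> V \<inter> X" "v \<in> V - X"
    show "c u \<noteq> c v"
    proof
      assume "c u = c v"
      then have "(u, v) \<in> ?M" "(v, u) \<in> ?M" using uv by (auto simp: mono_arcs_def H_def)
      then have "(u, u) \<in> ?M\<^sup>+" by auto
      then show False using c(2) by (auto simp: acyclic_def)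
    qed
  qed auto
  moreover have "V \<inter> X \<union> (V - X) = V" by auto
  ultimately show ?thesis by auto
qed

lemma (in digraph) dicolouring_if_dicol:
  assumes "dicol (arcs_ends G) k (verts G) c"
  shows "dicolouring G k c"
  unfolding dicolouring_def
proof (intro conjI ballI notI)
  show "c \<in> verts G \<rightarrow> {1..k}" using assms by (simp add: dicol_def)
  fix i
  let ?H = "G \<restriction> {v \<in> verts G. c v = i}"
  assume "\<exists>p. pre_digraph.cycle ?H p"
  then obtain p u where p: "pre_digraph.awalk ?H u p u" "p \<noteq> []"
    unfolding pre_digraph.cycle_def by blast
  interpret H: wf_digraph ?H by (rule wellformed_induce_subgraph)
  have "(u, u) \<in> (arcs_ends ?H)\<^sup>+" using p H.reachable1_awalk by blast
  moreover have "arcs_ends ?H \<subseteq> mono_arcs (arcs_ends G) (verts G) c"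
    by (auto simp: mono_arcs_def arcs_ends_def arc_to_ends_def)
  ultimately have "(u, u) \<in> (mono_arcs (arcs_ends G) (verts G) c)\<^sup>+"
    by (rule trancl_mono)
  then show False using assms by (auto simp: dicol_def acyclic_def)
qed

lemma (in fin_digraph) card_out_neighbours_le: "card (arcs_ends G `` {x} \<inter> W) \<le> out_degree G x"
proof -
  have "arcs_ends G `` {x} \<inter> W \<subseteq> head G ` out_arcs G x" by (auto simp: arcs_ends_def arc_to_ends_def)
  then have "card (arcs_ends G `` {x} \<inter> W) \<le> card (head G ` out_arcs G x)"
    by (intro card_mono) auto
  also have "\<dots> \<le> card (out_arcs G x)" by (intro card_image_le) auto
  finally show ?thesis by (simp add: out_degree_def)
qed

lemma (in fin_digraph) card_in_neighbours_le:
  "card ((arcs_ends G)\<inverse> `` {x} \<inter> W) \<le> in_degree G x"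
proof -
  have "(arcs_ends G)\<inverse> `` {x} \<inter> W \<subseteq> tail G ` in_arcs G x"
    by (auto simp: arcs_ends_def arc_to_ends_def)
  then have "card ((arcs_ends G)\<inverse> `` {x} \<inter> W) \<le> card (tail G ` in_arcs G x)"
    by (intro card_mono) auto
  also have "\<dots> \<le> card (in_arcs G x)" by (intro card_image_le) auto
  finally show ?thesis by (simp add: in_degree_def)
qed

theorem corollary8:
  fixes G :: "('a, 'b) pre_digraph"
  assumes "oriented_graph G"
    and "Delta_min G \<ge> 2"
  shows "dichromatic_number G \<le> Delta_min G"
proof -
  interpret oriented_graph G by fact
  have deg: "min (out_degree G x) (in_degree G x) \<le> Delta_min G" if "x \<in> verts G" for x
    using that by (auto simp: Delta_min_def intro!: Max_ge)
  have "\<exists>c. dicol (arcs_ends G) (Delta_min G) (verts G) c"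
  proof (rule oriented_min_degree_dicolourable[OF finite_verts])
    fix x assume "x \<in> verts G"
    then have "out_degree G x \<le> Delta_min G \<or> in_degree G x \<le> Delta_min G"
      using deg by (auto simp: min_le_iff_disj)
    then show "card (arcs_ends G `` {x} \<inter> verts G) \<le> Delta_min G \<or>
        card ((arcs_ends G)\<inverse> `` {x} \<inter> verts G) \<le> Delta_min G"
      using card_out_neighbours_le card_in_neighbours_le by (meson le_trans)
  qed (use assms(2) no_opposite_arcs in \<open>auto simp: adj_not_same\<close>)
  then obtain c where "dicolouring G (Delta_min G) c" using dicolouring_if_dicol by blast
  then show ?thesis unfolding dichromatic_number_def by (intro Least_le) blast
qed

end
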